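(* Let $k\ge1$ and $n\ge1$. Let $\tau$ be a $(k+1)$-bundled increasing tree of order $n$ and $\sigma=\Psi(\tau)$ the associated $k$-bundled Stirling permutation (via the bijection $\Psi$ described in the context). Then the number of ascents of $\sigma$ equals $B_A(\tau)$, the number of descents of $\sigma$ equals $B_D(\tau)$, and the number of plateaux of $\sigma$ equals $B_E(\tau)$.
   Context: A $k$-bundled Stirling permutation of order $n$ is a permutation $a_1\cdots a_\ell$ ($\ell=k+(k+2)(n-1)$) of the multiset $\{1^k,2^{k+2},\dots,n^{k+2}\}$ such that for each $i$ every entry between two occurrences of $i$ is at least $i$. With $a_0=a_{\ell+1}=0$, an index $i\in\{0,\dots,\ell\}$ is an ascent if $a_i<a_{i+1}$, a descent if $a_i>a_{i+1}$, a plateau if $a_i=a_{i+1}$. A $(k+1)$-bundled increasing tree of order $n$ is a rooted tree with vertex set $\{1,\dots,n\}$, root $1$, labels increasing along paths away from the root, in which every vertex has $k+1$ ordered bundles, each containing a (possibly empty) linearly ordered sequence of children; each non-root vertex lies in exactly one bundle of its parent. The bijection $\Psi$: for a non-root vertex $v$ with bundles whose subtree sequences are $(T_{i,1},\dots,T_{i,m_i})$, $i=1,\dots,k+1$, let $C_i=\mathrm{code}(T_{i,1})\cdots\mathrm{code}(T_{i,m_i})$ and $\mathrm{code}(\text{subtree at }v)=v\,C_1\,v\,C_2\,v\cdots v\,C_{k+1}\,v$ ($k+2$ copies of $v$). For the root, $\Psi(\tau)=C_1\,1\,C_2\,1\cdots1\,C_{k+1}$ ($k$ copies of $1$). This is a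 bijection onto $k$-bundled Stirling permutations of order $n$. Parameters: an ascent in a bundle is a pair of consecutive subtrees in the same bundle where the root of the left one is smaller than the root of the right one; a descent in a bundle is such a pair where the left root is larger. $B_A(\tau)$ = (number of ascents in bundles over all vertices) + (number of non-empty bundles over all vertices) + ($1$ if the first bundle of the root is empty, else $0$). $B_D(\tau)$ = (number of descents in bundles over all vertices) + (number of non-empty bundles) + ($1$ if the last bundle of the root is empty, else $0$). $B_E(\tau)$ = (number of empty bundles of vertices with label larger than $1$) + (number of empty bundles of the root among bundles $2,\dots,k$). *)

theory Defs
  imports "HOL-Library.Multiset"
begin

section \<open>Bundled increasing trees\<close>

text \<open>
  A vertex carries its label and the list of its bundles; each bundle is the list of the
  subtrees hanging from it, in order.  A vertex of a tree is represented by the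
  subtree rooted there, so sums over vertices are sums over \<open>subtrees\<close>.
\<close>

datatype btree = Node (root: nat) (bundles: "btree list list")

fun subtrees :: "btree \<Rightarrow> btree list" where
  "subtrees (Node v bs) = Node v bs # concat (map (\<lambda>b. concat (map subtrees b)) bs)"

definition labels :: "btree \<Rightarrow> nat list" where
  "labels t = map root (subtrees t)"

definition bundled_increasing_tree :: "nat \<Rightarrow> nat \<Rightarrow> btree \<Rightarrow> bool" where
  "bundled_increasing_tree d n t \<longleftrightarrow>
     root t = 1 \<and>
     distinct (labels t) \<and> set (labels t) = {1..n} \<and>
     (\<forall>s \<in> set (subtrees t). length (bundles s) = d) \<and>
     (\<forall>s \<in> set (subtrees t). \<forall>b \<in> set (bundles s). \<forall>c \<in> set b. root s < root c)"

section \<open>Bundled Stirling permutations\<close>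

definition stirling_word :: "nat list \<Rightarrow> bool" where
  "stirling_word w \<longleftrightarrow>
     (\<forall>i j l. i < j \<longrightarrow> j < l \<longrightarrow> l < length w \<longrightarrow> w ! i = w ! l \<longrightarrow> w ! i \<le> w ! j)"

definition bundled_stirling_perm :: "nat \<Rightarrow> nat \<Rightarrow> nat list \<Rightarrow> bool" where
  "bundled_stirling_perm k n w \<longleftrightarrow>
     mset w = replicate_mset k 1 + (\<Sum>i\<in>{2..n}. replicate_mset (k + 2) i) \<and> stirling_word w"

text \<open>The word \<open>w\<close> occupies the positions \<open>1, \<dots>, length w\<close> of \<open>padded w\<close>, as in the convention
  that the entries before the first and after the last one are \<open>0\<close>.\<close>

definition padded :: "nat list \<Rightarrow> nat list" where
  "padded w = 0 # w @ [0]"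

definition ascents :: "nat list \<Rightarrow> nat" where
  "ascents w = card {i \<in> {0..length w}. padded w ! i < padded w ! (i + 1)}"

definition descents :: "nat list \<Rightarrow> nat" where
  "descents w = card {i \<in> {0..length w}. padded w ! i > padded w ! (i + 1)}"

definition plateaux :: "nat list \<Rightarrow> nat" where
  "plateaux w = card {i \<in> {0..length w}. padded w ! i = padded w ! (i + 1)}"

section \<open>The map from trees to words\<close>

text \<open>\<open>interleave v [C\<^sub>1, \<dots>, C\<^sub>d]\<close> is \<open>C\<^sub>1 v C\<^sub>2 v \<dots> v C\<^sub>d\<close>, with \<open>d - 1\<close> copies of \<open>v\<close>.\<close>

fun interleave :: "'a \<Rightarrow> 'a list list \<Rightarrow> 'a list" where
  "interleave v [] = []"
| "interleave v [C] = C"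
| "interleave v (C # D # Cs) = C @ v # interleave v (D # Cs)"

fun code :: "btree \<Rightarrow> nat list" where
  "code (Node v bs) = v # interleave v (map (\<lambda>b. concat (map code b)) bs) @ [v]"

definition Psi :: "btree \<Rightarrow> nat list" where
  "Psi t = interleave 1 (map (\<lambda>b. concat (map code b)) (bundles t))"

section \<open>Tree statistics\<close>

definition bundle_ascents :: "btree list \<Rightarrow> nat" where
  "bundle_ascents b = card {j. Suc j < length b \<and> root (b ! j) < root (b ! Suc j)}"

definition bundle_descents :: "btree list \<Rightarrow> nat" where
  "bundle_descents b = card {j. Suc j < length b \<and> root (b ! j) > root (b ! Suc j)}"

definition nonempty_bundles :: "btree \<Rightarrow> nat" where
  "nonempty_bundles s = card {i. i < length (bundles s) \<and> bundles s ! i \<noteq> []}"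

definition empty_bundles :: "btree \<Rightarrow> nat" where
  "empty_bundles s = card {i. i < length (bundles s) \<and> bundles s ! i = []}"

definition B_A :: "btree \<Rightarrow> nat" where
  "B_A t =
     (\<Sum>s\<leftarrow>subtrees t. \<Sum>b\<leftarrow>bundles s. bundle_ascents b)
     + (\<Sum>s\<leftarrow>subtrees t. nonempty_bundles s)
     + (if hd (bundles t) = [] then 1 else 0)"

definition B_D :: "btree \<Rightarrow> nat" where
  "B_D t =
     (\<Sum>s\<leftarrow>subtrees t. \<Sum>b\<leftarrow>bundles s. bundle_descents b)
     + (\<Sum>s\<leftarrow>subtrees t. nonempty_bundles s)
     + (if last (bundles t) = [] then 1 else 0)"

text \<open>In \<open>B_E\<close> the bundles \<open>2, \<dots>, k\<close> of the root of a \<open>(k + 1)\<close>-bundled tree are those at the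
  list positions \<open>1, \<dots>, k - 1\<close>.\<close>

definition B_E :: "nat \<Rightarrow> btree \<Rightarrow> nat" where
  "B_E k t =
     (\<Sum>s\<leftarrow>filter (\<lambda>s. root s > 1) (subtrees t). empty_bundles s)
     + card {i \<in> {2..k}. bundles t ! (i - 1) = []}"

section \<open>The word of a tree is a bundled Stirling permutation\<close>

lemma stirling_word_append:
  assumes "stirling_word u" "stirling_word w"
    and "set u \<inter> set w \<subseteq> {v}" "\<And>x. x \<in> set u \<union> set w \<Longrightarrow> v \<le> x"
  shows "stirling_word (u @ w)"
  unfolding stirling_word_def
proof (intro allI impI)
  fix i j l
  assume ijl: "i < j" "j < l" "l < length (u @ w)" and eq: "(u @ w) ! i = (u @ w) ! l"
  have jv: "v \<le> (u @ w) ! j"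
    using assms(4) ijl nth_mem[of j "u @ w"] by (metis less_trans set_append)
  consider "l < length u" | "length u \<le> i" | "i < length u" "length u \<le> l" by linarith
  then show "(u @ w) ! i \<le> (u @ w) ! j"
  proof cases
    case 1
    with ijl eq assms(1) show ?thesis by (simp add: stirling_word_def nth_append)
  next
    case 2
    have "i - length u < j - length u" "j - length u < l - length u" "l - length u < length w"
      using ijl 2 by auto
    moreover have "w ! (i - length u) = w ! (l - length u)"
      using eq 2 ijl by (simp add: nth_append)
    ultimately have "w ! (i - length u) \<le> w ! (j - length u)"
      using assms(2) unfolding stirling_word_def by blast
    with 2 ijl show ?thesis by (simp add: nth_append)
  next
    case 3
    then have "(u @ w) ! i \<in> set u" "(u @ w) ! l \<in> set w"
      using ijl by (auto simp: nth_append)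
    with eq assms(3) have "(u @ w) ! i = v" by auto
    with jv show ?thesis by simp
  qed
qed

lemma set_interleave: "insert v (set (interleave v Cs)) = insert v (\<Union>(set ` set Cs))"
  by (induction v Cs rule: interleave.induct) auto

lemma mset_interleave:
  "mset (interleave v Cs) = replicate_mset (length Cs - 1) v + mset (concat Cs)"
  by (induction v Cs rule: interleave.induct) auto

lemma labels_Node [simp]:
  "labels (Node v bs) = v # concat (map (\<lambda>b. concat (map labels b)) bs)"
  by (simp add: labels_def[abs_def] map_concat o_def)

lemma stirling_word_concat:
  assumes "distinct (concat (map g xs))"
    and "\<And>x. x \<in> set xs \<Longrightarrow> stirling_word (f x) \<and> set (f x) = set (g x)"
  shows "stirling_word (concat (map f xs))"
  using assms
proof (induction xs)
  case Nil
  then show ?case by (simp add: stirling_word_def)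
next
  case (Cons x xs)
  have "set (f x) \<inter> set (concat (map f xs)) \<subseteq> {0}"
    using Cons.prems by fastforce
  with Cons show ?case by (auto intro!: stirling_word_append[where v = 0])
qed

lemma stirling_word_interleave:
  assumes "distinct (concat (map g xs))"
    and "\<And>x. x \<in> set xs \<Longrightarrow> stirling_word (f x) \<and> set (f x) = set (g x)"
    and "\<And>x y. x \<in> set xs \<Longrightarrow> y \<in> set (g x) \<Longrightarrow> v < y"
  shows "stirling_word (interleave v (map f xs))"
  using assms
proof (induction xs rule: induct_list012)
  case 1
  then show ?case by (simp add: stirling_word_def)
next
  case (2 x)
  then show ?case by simp
next
  case (3 x y zs)
  let ?w = "interleave v (map f (y # zs))"
  have IH: "stirling_word ?w" using 3 by (auto simp del: interleave.simps)
  have w: "set ?w \<subseteq> insert v (\<Union>z\<in>set (y # zs). set (g z))"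
    using set_interleave[of v "map f (y # zs)"] "3.prems"(2) by fastforce
  have ge: "\<And>z. z \<in> set ?w \<Longrightarrow> v \<le> z" using w "3.prems"(3) by fastforce
  have "stirling_word ([v] @ ?w)"
    by (rule stirling_word_append[where v = v]) (use IH ge in \<open>auto simp: stirling_word_def\<close>)
  moreover have "set (f x) \<inter> set ([v] @ ?w) \<subseteq> {v}"
  proof -
    have "set (g x) \<inter> (\<Union>z\<in>set (y # zs). set (g z)) = {}"
      using "3.prems"(1) by fastforce
    moreover have "set (f x) = set (g x)" using "3.prems"(2) by simp
    ultimately show ?thesis using w by auto
  qed
  moreover have "\<And>z. z \<in> set (f x) \<union> set ([v] @ ?w) \<Longrightarrow> v \<le> z"
    using ge "3.prems"(2,3) by fastforce
  moreover have "stirling_word (f x)" using "3.prems"(2) by simp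
  ultimately have "stirling_word (f x @ [v] @ ?w)"
    by (intro stirling_word_append[of "f x" "[v] @ ?w" v]) blast+
  then show ?case by simp
qed

lemma set_code: "set (code t) = set (labels t)"
proof (induction t)
  case (Node v bs)
  then show ?case
    using set_interleave[of v "map (\<lambda>b. concat (map code b)) bs"] by auto
qed

lemma root_le_labels:
  assumes "\<forall>s \<in> set (subtrees t). \<forall>b \<in> set (bundles s). \<forall>c \<in> set b. root s < root c"
    and "x \<in> set (labels t)"
  shows "root t \<le> x"
  using assms
proof (induction t)
  case (Node v bs)
  show ?case
  proof (cases "x = v")
    case False
    then obtain b c where bc: "b \<in> set bs" "c \<in> set b" "x \<in> set (labels c)"
      using Node.prems(2) by auto
    then have "root c \<le> x" using Node by auto
    moreover have "v < root c" using bc Node.prems(1) by auto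
    ultimately show ?thesis by simp
  qed simp
qed

lemma distinct_concat_mapD:
  "distinct (concat (map g xs)) \<Longrightarrow> x \<in> set xs \<Longrightarrow> distinct (g x)"
  by (induction xs) auto

lemma stirling_word_code:
  assumes "\<forall>s \<in> set (subtrees t). \<forall>b \<in> set (bundles s). \<forall>c \<in> set b. root s < root c"
    and "distinct (labels t)"
  shows "stirling_word (code t) \<and>
    stirling_word (interleave (root t) (map (\<lambda>b. concat (map code b)) (bundles t)))"
  using assms
proof (induction t)
  case (Node v bs)
  let ?L = "\<lambda>b. concat (map labels b)" and ?C = "\<lambda>b. concat (map code b)"
  let ?I = "interleave v (map ?C bs)"
  have dist: "distinct (concat (map ?L bs))" using Node.prems(2) by simp
  have distb: "distinct (?L b)" if "b \<in> set bs" for b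
    using dist that by (rule distinct_concat_mapD)
  have distc: "distinct (labels c)" if "b \<in> set bs" "c \<in> set b" for b c
    using distb[OF that(1)] that(2) by (rule distinct_concat_mapD)
  have inc: "\<forall>s \<in> set (subtrees c). \<forall>b \<in> set (bundles s). \<forall>c \<in> set b. root s < root c"
    if "b \<in> set bs" "c \<in> set b" for b c
    using Node.prems(1) that by fastforce
  have sC: "stirling_word (?C b) \<and> set (?C b) = set (?L b)" if b: "b \<in> set bs" for b
  proof
    show "stirling_word (?C b)"
      using distb[OF b]
    proof (rule stirling_word_concat)
      fix c assume c: "c \<in> set b"
      show "stirling_word (code c) \<and> set (code c) = set (labels c)"
        using Node.IH[OF b c inc[OF b c] distc[OF b c]] set_code by blast
    qed
    show "set (?C b) = set (?L b)" by (simp add: set_code)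
  qed
  have gt: "v < y" if b: "b \<in> set bs" and y: "y \<in> set (?L b)" for b y
  proof -
    obtain c where c: "c \<in> set b" "y \<in> set (labels c)" using y by auto
    have "root c \<le> y"
      using inc[OF b c(1)] c(2) by (rule root_le_labels)
    moreover have "v < root c" using Node.prems(1) b c by auto
    ultimately show ?thesis by simp
  qed
  have I: "stirling_word ?I"
    using dist sC gt by (rule stirling_word_interleave)
  have ge: "v \<le> y" if "y \<in> set ?I" for y
  proof -
    from that have "y \<in> insert v (\<Union>(set ` set (map ?C bs)))"
      using set_interleave[of v "map ?C bs"] by blast
    then consider "y = v" | b where "b \<in> set bs" "y \<in> set (?C b)"
      by (auto simp del: set_concat)
    then show ?thesis
    proof cases
      case 2
      then have "y \<in> set (?L b)" using sC by blast
      with 2 gt show ?thesis by (simp add: less_imp_le del: set_concat)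
    qed simp
  qed
  have "stirling_word (?I @ [v])"
    by (rule stirling_word_append[where v = v]) (use I ge in \<open>auto simp: stirling_word_def\<close>)
  then have "stirling_word ([v] @ ?I @ [v])"
    by (intro stirling_word_append[of "[v]" "?I @ [v]" v]) (use ge in \<open>auto simp: stirling_word_def\<close>)
  with I show ?case by simp
qed

lemma mset_concat_map:
  assumes "\<And>x. x \<in> set xs \<Longrightarrow> mset (f x) = repeat_mset m (mset (g x))"
  shows "mset (concat (map f xs)) = repeat_mset m (mset (concat (map g xs)))"
  using assms by (induction xs) auto

lemma mset_code:
  assumes "\<forall>s \<in> set (subtrees t). length (bundles s) = k + 1"
  shows "mset (code t) = repeat_mset (k + 2) (mset (labels t))"
    (is "?P t")
  using assms
proof (induction t)
  case (Node v bs)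
  have "?P c" if "b \<in> set bs" "c \<in> set b" for b c
    using Node.IH[OF that] Node.prems that by fastforce
  then have "mset (concat (map (\<lambda>b. concat (map code b)) bs)) =
      repeat_mset (k + 2) (mset (concat (map (\<lambda>b. concat (map labels b)) bs)))"
    by (intro mset_concat_map) blast
  moreover have "length bs = k + 1" using Node.prems by simp
  ultimately show ?case by (simp add: mset_interleave)
qed

theorem Psi_bundled_stirling_perm:
  assumes "bundled_increasing_tree (k + 1) n t"
  shows "bundled_stirling_perm k n (Psi t)"
proof -
  obtain v bs where t: "t = Node v bs" by (cases t)
  let ?Ls = "concat (map (\<lambda>b. concat (map labels b)) bs)"
  have v: "v = 1" and len: "length bs = k + 1"
    and dist: "distinct (1 # ?Ls)" and lab: "insert 1 (set ?Ls) = {1..n}"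
    using assms unfolding bundled_increasing_tree_def t by (auto simp del: set_concat)
  have "mset (code c) = repeat_mset (k + 2) (mset (labels c))"
    if "b \<in> set bs" "c \<in> set b" for b c
    using assms that unfolding bundled_increasing_tree_def t by (intro mset_code) fastforce
  then have C: "mset (concat (map (\<lambda>b. concat (map code b)) bs)) = repeat_mset (k + 2) (mset ?Ls)"
    by (intro mset_concat_map) blast
  have "set ?Ls = {1..n} - {1}" using dist lab by auto
  also have "\<dots> = {2..n}" by auto
  finally have "mset ?Ls = mset_set {2..n}"
    using dist by (metis distinct.simps(2) mset_set_set)
  moreover have "repeat_mset (k + 2) (mset_set A) = (\<Sum>i\<in>A. replicate_mset (k + 2) i)"
    if "finite A" for A :: "nat set"
    using that by (induction A) auto
  ultimately have "mset (Psi t) = replicate_mset k 1 + (\<Sum>i\<in>{2..n}. replicate_mset (k + 2) i)"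
    using C len unfolding Psi_def t by (simp add: mset_interleave)
  moreover have "stirling_word (Psi t)"
    using stirling_word_code[of t] assms
    unfolding bundled_increasing_tree_def Psi_def by simp
  ultimately show ?thesis by (simp add: bundled_stirling_perm_def)
qed

end

theory Submission
  imports Defs
begin

text \<open>
  Ascents, descents and plateaux all count adjacent pairs of the padded word standing in a relation
  \<open>R\<close>.  Since the code of a subtree starts and ends with the label of its root, collapsing the codes
  of the subtrees in a bundle of \<open>v\<close> to the root labels shows that the count for \<open>code t\<close> is the sum,
  over all vertices \<open>v\<close> and all bundles of \<open>v\<close> with child labels \<open>c\<^sub>1, \<dots>, c\<^sub>m\<close>, of the counts for
  the words \<open>v c\<^sub>1 \<dots> c\<^sub>m v\<close>, and these are evaluated using \<open>v < c\<^sub>i\<close>.  As \<open>code t\<close> is \<open>Psi t\<close> with \<open>1\<close>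
  instead of \<open>0\<close> at both ends, only the first and the last pair need a correction at the root.
\<close>

section \<open>Adjacent pairs of a word standing in a relation\<close>

fun adj_count :: "('a \<Rightarrow> 'a \<Rightarrow> bool) \<Rightarrow> 'a list \<Rightarrow> nat" where
  "adj_count R (x # y # zs) = of_bool (R x y) + adj_count R (y # zs)"
| "adj_count R _ = 0"

text \<open>The shared entry \<open>y\<close> closes the left word and opens the right one, so
  cutting there neither loses a pair nor counts one twice.\<close>

lemma adj_count_append:
  "adj_count R (xs @ y # zs) = adj_count R (xs @ [y]) + adj_count R (y # zs)"
  by (induction xs rule: induct_list012) auto

lemma adj_count_Cons:
  "xs \<noteq> [] \<Longrightarrow> adj_count R (x # xs) = of_bool (R x (hd xs)) + adj_count R xs"
  by (cases xs) auto

lemma adj_count_snoc: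
  "xs \<noteq> [] \<Longrightarrow> adj_count R (xs @ [y]) = adj_count R xs + of_bool (R (last xs) y)"
  by (induction xs rule: induct_list012) auto

lemma adj_count_Cons_snoc:
  "xs \<noteq> [] \<Longrightarrow>
    adj_count R (x # xs @ [y]) = of_bool (R x (hd xs)) + adj_count R xs + of_bool (R (last xs) y)"
  by (simp add: adj_count_Cons adj_count_snoc)

lemma adj_count_conv_card:
  "adj_count R xs = card {i. Suc i < length xs \<and> R (xs ! i) (xs ! Suc i)}"
proof (induction xs rule: induct_list012)
  case (3 x y zs)
  let ?S = "\<lambda>ws. {i. Suc i < length ws \<and> R (ws ! i) (ws ! Suc i)}"
  \<comment> \<open>Position 0 carries the pair \<open>x\<close>, \<open>y\<close>; all later pairs
    are those of \<open>y # zs\<close>, shifted by one.\<close>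
  have "?S (x # y # zs) = (if R x y then {0} else {}) \<union> Suc ` ?S (y # zs)"
  proof (intro set_eqI)
    fix i show "i \<in> ?S (x # y # zs) \<longleftrightarrow> i \<in> (if R x y then {0} else {}) \<union> Suc ` ?S (y # zs)"
      by (cases i) auto
  qed
  moreover have "finite (?S (y # zs))" by (rule finite_subset[of _ "{..<length (y # zs)}"]) auto
  ultimately have "card (?S (x # y # zs)) = of_bool (R x y) + card (?S (y # zs))"
    by (auto simp: card_image card_insert_if)
  with 3 show ?case by simp
qed auto

lemma adj_count_eq_distinct: "distinct xs \<Longrightarrow> adj_count (=) xs = 0"
  by (induction xs rule: induct_list012) auto

text \<open>With \<open>R\<close> left free, one formula serves \<open>ascents\<close>,
  \<open>descents\<close> and \<open>plateaux\<close>.\<close>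

lemma padded_adj_count:
  "card {i \<in> {0..length w}. R (padded w ! i) (padded w ! (i + 1))} = adj_count R (0 # w @ [0])"
  by (simp add: adj_count_conv_card padded_def less_Suc_eq_le)

lemma bundle_adj_count:
  "card {j. Suc j < length b \<and> R (root (b ! j)) (root (b ! Suc j))} = adj_count R (map root b)"
  unfolding adj_count_conv_card by (rule arg_cong[of _ _ card]) auto

section \<open>Collapsing codes to root labels\<close>

text \<open>Each separating \<open>v\<close> ends one block and begins the next, so the word can be
  cut at every copy. For \<open>Cs = []\<close> the left side would still count the pair
  \<open>v\<close>, \<open>v\<close>.\<close>

lemma adj_count_interleave:
  assumes "Cs \<noteq> []"
  shows "adj_count R (v # interleave v Cs @ [v]) = (\<Sum>C\<leftarrow>Cs. adj_count R (v # C @ [v]))"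
  using assms
proof (induction v Cs rule: interleave.induct)
  case (3 v C D Cs)
  then show ?case
    using adj_count_append[of R "v # C" v "interleave v (D # Cs) @ [v]"] by simp
qed auto

text \<open>\<open>code t\<close> begins and ends with \<open>root t\<close>: the cut is made at its
  last letter, and what precedes or follows sees only the root label.\<close>

lemma adj_count_Cons_code:
  "adj_count R (a # code t @ zs) =
    of_bool (R a (root t)) + adj_count R (code t) + adj_count R (root t # zs)"
proof (cases t)
  case (Node v bs)
  then show ?thesis
    using adj_count_append[of R "a # v # interleave v (map (\<lambda>b. concat (map code b)) bs)" v zs]
    by simp
qed

text \<open>After the first code has been split off, its root label takes over the role of
  \<open>a\<close>; hence the generalization over \<open>a\<close>.\<close>

lemma adj_count_codes:
  "adj_count R (a # concat (map code b) @ [c]) =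
    adj_count R (a # map root b @ [c]) + (\<Sum>t\<leftarrow>b. adj_count R (code t))"
  by (induction b arbitrary: a) (auto simp: adj_count_Cons_code)

lemma adj_count_code:
  assumes "\<forall>s \<in> set (subtrees t). bundles s \<noteq> []"
  shows "adj_count R (code t) =
    (\<Sum>s\<leftarrow>subtrees t. \<Sum>b\<leftarrow>bundles s. adj_count R (root s # map root b @ [root s]))"
    (is "?P t")
  using assms
proof (induction t)
  case (Node v bs)
  let ?f = "\<lambda>s. \<Sum>b\<leftarrow>bundles s. adj_count R (root s # map root b @ [root s])"
  have IH: "?P c" if "b \<in> set bs" "c \<in> set b" for b c
    using Node.IH[OF that] Node.prems that by fastforce
  have sum_concat: "sum_list (map g (concat xss)) = (\<Sum>xs\<leftarrow>xss. sum_list (map g xs))"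
    for g :: "btree \<Rightarrow> nat" and xss
    by (induction xss) auto
  have "adj_count R (code (Node v bs)) =
      (\<Sum>b\<leftarrow>bs. adj_count R (v # map root b @ [v]) + (\<Sum>c\<leftarrow>b. adj_count R (code c)))"
    using Node.prems by (simp add: adj_count_interleave adj_count_codes o_def)
  also have "\<dots> = (\<Sum>b\<leftarrow>bs. adj_count R (v # map root b @ [v])) +
      (\<Sum>b\<leftarrow>bs. \<Sum>c\<leftarrow>b. adj_count R (code c))"
    by (rule sum_list_addf)
  also have "(\<Sum>b\<leftarrow>bs. \<Sum>c\<leftarrow>b. adj_count R (code c)) =
      (\<Sum>b\<leftarrow>bs. \<Sum>c\<leftarrow>b. sum_list (map ?f (subtrees c)))"
    using IH by (intro arg_cong[of _ _ sum_list] map_cong refl) blast+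
  finally show ?case by (simp add: sum_concat o_def)
qed

section \<open>Bundle counts as sums, and distinctness of sibling labels\<close>

lemma card_nth_eq_sum_list:
  "card {i. i < length xs \<and> P (xs ! i)} = (\<Sum>x\<leftarrow>xs. of_bool (P x))"
  unfolding length_filter_conv_card[symmetric] by (induction xs) auto

lemma nonempty_bundles_sum: "nonempty_bundles s = (\<Sum>b\<leftarrow>bundles s. of_bool (b \<noteq> []))"
  unfolding nonempty_bundles_def by (rule card_nth_eq_sum_list)

lemma empty_bundles_sum: "empty_bundles s = (\<Sum>b\<leftarrow>bundles s. of_bool (b = []))"
  unfolding empty_bundles_def by (rule card_nth_eq_sum_list)

lemma root_in_labels: "root t \<in> set (labels t)"
  by (cases t) simp

text \<open>Each root is a label of its own subtree, so a repeated root would be a repeated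
  label.\<close>

lemma distinct_roots: "distinct (concat (map labels b)) \<Longrightarrow> distinct (map root b)"
proof (induction b)
  case (Cons c b)
  then have "root c \<notin> root ` set b"
    using root_in_labels by (auto simp: disjoint_iff) metis
  with Cons show ?case by simp
qed simp

lemma distinct_labels_subtrees:
  "distinct (labels t) \<Longrightarrow> s \<in> set (subtrees t) \<Longrightarrow> distinct (labels s)"
proof (induction t)
  case (Node v bs)
  show ?case
  proof (cases "s = Node v bs")
    case False
    then obtain b c where bc: "b \<in> set bs" "c \<in> set b" "s \<in> set (subtrees c)"
      using Node.prems(2) by auto
    have "distinct (concat (map (\<lambda>b. concat (map labels b)) bs))" using Node.prems(1) by simp
    from distinct_concat_mapD[OF distinct_concat_mapD[OF this bc(1)] bc(2)]
    have "distinct (labels c)" .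
    with Node.IH bc show ?thesis by blast
  qed (use Node.prems in simp)
qed

lemma distinct_bundle_roots:
  assumes "distinct (labels t)" "s \<in> set (subtrees t)" "b \<in> set (bundles s)"
  shows "distinct (map root b)"
proof (cases s)
  case (Node v bs)
  then have "distinct (concat (map (\<lambda>b. concat (map labels b)) bs))"
    using distinct_labels_subtrees[OF assms(1,2)] by simp
  from distinct_concat_mapD[OF this, of b] assms(3) Node show ?thesis by (simp add: distinct_roots)
qed

section \<open>Evaluating the count for the code of a tree\<close>

context
  fixes d n t
  assumes tree: "bundled_increasing_tree d n t" and d: "d > 0"
begin

lemma root_less_child:
  "s \<in> set (subtrees t) \<Longrightarrow> b \<in> set (bundles s) \<Longrightarrow> c \<in> set b \<Longrightarrow> root s < root c"
  using tree unfolding bundled_increasing_tree_def by blast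

lemma bundles_ne: "\<forall>s \<in> set (subtrees t). bundles s \<noteq> []"
  using tree d unfolding bundled_increasing_tree_def by force

text \<open>For a vertex \<open>v\<close>, a non-empty bundle adds one ascent, from \<open>v\<close>
  to its first child; the return from the last child to \<open>v\<close> is a descent. An empty
  bundle yields only \<open>v\<close>, \<open>v\<close>.\<close>

lemma code_ascents:
  "adj_count (<) (code t) =
    (\<Sum>s\<leftarrow>subtrees t. \<Sum>b\<leftarrow>bundles s. bundle_ascents b) + (\<Sum>s\<leftarrow>subtrees t. nonempty_bundles s)"
proof -
  have "adj_count (<) (root s # map root b @ [root s]) = bundle_ascents b + of_bool (b \<noteq> [])"
    if "s \<in> set (subtrees t)" "b \<in> set (bundles s)" for s b
  proof (cases "b = []")
    case False
    then have "root s < root (hd b)" "root s < root (last b)"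
      using root_less_child[OF that] by auto
    with False show ?thesis
      by (simp add: adj_count_Cons_snoc hd_map last_map bundle_ascents_def bundle_adj_count)
  qed (simp add: bundle_ascents_def)
  then show ?thesis
    unfolding adj_count_code[OF bundles_ne] nonempty_bundles_sum sum_list_addf[symmetric]
    by (intro arg_cong[of _ _ sum_list] map_cong refl)
qed

lemma code_descents:
  "adj_count (>) (code t) =
    (\<Sum>s\<leftarrow>subtrees t. \<Sum>b\<leftarrow>bundles s. bundle_descents b) + (\<Sum>s\<leftarrow>subtrees t. nonempty_bundles s)"
proof -
  have "adj_count (>) (root s # map root b @ [root s]) = bundle_descents b + of_bool (b \<noteq> [])"
    if "s \<in> set (subtrees t)" "b \<in> set (bundles s)" for s b
  proof (cases "b = []")
    case False
    then have "root s < root (hd b)" "root s < root (last b)"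
      using root_less_child[OF that] by auto
    with False show ?thesis
      \<comment> \<open>The relation is given explicitly because \<open>x > y\<close> abbreviates
        \<open>y < x\<close>, which hides it from matching.\<close>
      by (simp add: adj_count_Cons_snoc hd_map last_map bundle_descents_def
          bundle_adj_count[of _ "(>)"])
  qed (simp add: bundle_descents_def)
  then show ?thesis
    unfolding adj_count_code[OF bundles_ne] nonempty_bundles_sum sum_list_addf[symmetric]
    by (intro arg_cong[of _ _ sum_list] map_cong refl)
qed

text \<open>Siblings have distinct labels, all larger than that of their parent, so only the pair
  \<open>v\<close>, \<open>v\<close> of an empty bundle is a plateau.\<close>

lemma code_plateaux: "adj_count (=) (code t) = (\<Sum>s\<leftarrow>subtrees t. empty_bundles s)"
proof -
  have "adj_count (=) (root s # map root b @ [root s]) = of_bool (b = [])"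
    if "s \<in> set (subtrees t)" "b \<in> set (bundles s)" for s b
  proof (cases "b = []")
    case False
    then have "root s < root (hd b)" "root s < root (last b)"
      using root_less_child[OF that] by auto
    moreover have "distinct (map root b)"
      using tree that unfolding bundled_increasing_tree_def by (blast intro: distinct_bundle_roots)
    ultimately show ?thesis
      using False by (simp add: adj_count_Cons_snoc hd_map last_map adj_count_eq_distinct)
  qed simp
  then show ?thesis
    unfolding adj_count_code[OF bundles_ne] empty_bundles_sum
    by (intro arg_cong[of _ _ sum_list] map_cong refl)
qed

text \<open>All labels lie in \<open>{1..n}\<close> and by distinctness only the root carries 1, so
  the filter removes exactly the root.\<close>

lemma empty_bundles_split_root:
  "(\<Sum>s\<leftarrow>subtrees t. empty_bundles s) =
    empty_bundles t + (\<Sum>s\<leftarrow>filter (\<lambda>s. root s > 1) (subtrees t). empty_bundles s)"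
proof -
  obtain rest where rest: "subtrees t = t # rest" by (cases t) auto
  have root: "root t = 1" and "distinct (map root (subtrees t))"
    and lab: "root ` set (subtrees t) = {1..n}"
    using tree unfolding bundled_increasing_tree_def labels_def by auto
  then have notin: "1 \<notin> root ` set rest" by (simp add: rest)
  have "root s > 1" if "s \<in> set rest" for s
  proof -
    have "root s \<in> {1..n}" using that rest lab by (metis imageI list.set_intros(2))
    moreover have "root s \<noteq> 1" using that notin by (metis imageI)
    ultimately show ?thesis by simp
  qed
  then have "filter (\<lambda>s. root s > 1) rest = rest" by (simp add: filter_id_conv)
  with rest root show ?thesis by simp
qed

end

section \<open>First and last letters, and the bundles of the root\<close>

lemma hd_concat_code: "b \<noteq> [] \<Longrightarrow> hd (concat (map code b) @ zs) = root (hd b)"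
proof (cases b)
  case (Cons c cs)
  then show ?thesis by (cases c) simp
qed simp

lemma last_concat_code: "b \<noteq> [] \<Longrightarrow> last (zs @ concat (map code b)) = root (last b)"
proof (cases b rule: rev_cases)
  case (snoc cs c)
  then show ?thesis by (cases c) simp
qed simp

text \<open>With at least two blocks a separator \<open>v\<close> exists, and it comes first when
  the first block is empty.\<close>

lemma hd_interleave:
  "length Cs \<ge> 2 \<Longrightarrow> hd (interleave v Cs) = (if hd Cs = [] then v else hd (hd Cs))"
  by (cases "(v, Cs)" rule: interleave.cases) auto

lemma interleave_ne: "length Cs \<ge> 2 \<Longrightarrow> interleave v Cs \<noteq> []"
  by (cases "(v, Cs)" rule: interleave.cases) auto

lemma last_interleave:
  "length Cs \<ge> 2 \<Longrightarrow> last (interleave v Cs) = (if last Cs = [] then v else last (last Cs))"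
proof (induction v Cs rule: interleave.induct)
  case (3 v C D Cs)
  then show ?case by (cases Cs) (auto simp: interleave_ne)
qed auto

text \<open>As \<open>k \<ge> 1\<close>, the first and the last bundle are different ones, and the
  bundles between them are those numbered 2 to \<open>k\<close>.\<close>

lemma empty_bundles_root:
  assumes "length (bundles t) = k + 1" "k \<ge> 1"
  shows "empty_bundles t = of_bool (hd (bundles t) = []) + of_bool (last (bundles t) = [])
    + card {i \<in> {2..k}. bundles t ! (i - 1) = []}"
proof -
  obtain b ds e where bs: "bundles t = b # ds @ [e]"
    using assms by (metis One_nat_def Suc_eq_plus1 append_butlast_last_id length_0_conv
        length_Suc_conv not_one_le_zero)
  \<comment> \<open>Bundle numbers start at 1 and \<open>ds\<close> starts with bundle 2, so
    position \<open>i\<close> of \<open>ds\<close> is bundle \<open>i + 2\<close>.\<close>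
  have "{i \<in> {2..k}. bundles t ! (i - 1) = []} = (\<lambda>i. i + 2) ` {i. i < length ds \<and> ds ! i = []}"
    (is "?A = ?f ` ?B")
  proof (intro equalityI subsetI)
    fix i assume i: "i \<in> ?A"
    then have "i - 2 \<in> ?B" "i = ?f (i - 2)"
      using assms bs by (auto simp: le_iff_add nth_append)
    then show "i \<in> ?f ` ?B" by blast
  qed (use assms bs in \<open>auto simp: nth_append\<close>)
  then have "card ?A = (\<Sum>b\<leftarrow>ds. of_bool (b = []))"
    by (simp only: card_nth_eq_sum_list[of ds "\<lambda>b. b = []"] card_image[OF inj_on_add'])
  then show ?thesis
    by (simp only: empty_bundles_sum) (simp add: bs)
qed

theorem theorem3p14:
  fixes k n :: nat and \<tau> :: btree and \<sigma> :: "nat list"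
  assumes "k \<ge> 1" and "n \<ge> 1"
    and "bundled_increasing_tree (k + 1) n \<tau>"
    and "\<sigma> = Psi \<tau>"
  shows "ascents \<sigma> = B_A \<tau> \<and> descents \<sigma> = B_D \<tau> \<and> plateaux \<sigma> = B_E k \<tau>"
proof -
  obtain bs where t: "\<tau> = Node 1 bs"
    using assms(3) by (cases \<tau>) (simp add: bundled_increasing_tree_def)
  have len: "length bs = k + 1"
    using assms(3) by (simp add: bundled_increasing_tree_def t)
  let ?Cs = "map (\<lambda>b. concat (map code b)) bs"
  have \<sigma>: "\<sigma> = interleave 1 ?Cs" by (simp add: assms(4) Psi_def t)
  have len2: "length ?Cs \<ge> 2" and bs: "bs \<noteq> []" using len assms(1) by auto
  have ne: "\<sigma> \<noteq> []" using interleave_ne[OF len2] by (simp add: \<sigma>)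
  have code_ne: "concat (map code b) = [] \<longleftrightarrow> b = []" for b
    by (cases b; cases "hd b") auto
  have child: "1 < root c" if "b \<in> set bs" "c \<in> set b" for b c
    using root_less_child[OF assms(3), of \<tau> b c] that by (simp add: t)
  have hd_\<sigma>: "hd \<sigma> = (if hd bs = [] then 1 else root (hd (hd bs)))"
    using hd_interleave[OF len2, of 1] hd_concat_code[of "hd bs" "[]"] bs
    by (simp add: \<sigma> hd_map code_ne del: concat_eq_Nil_conv)
  have last_\<sigma>: "last \<sigma> = (if last bs = [] then 1 else root (last (last bs)))"
    using last_interleave[OF len2, of 1] last_concat_code[of "last bs" "[]"] bs
    by (simp add: \<sigma> last_map code_ne del: concat_eq_Nil_conv)
  have hd_gt: "1 < root (hd (hd bs))" if "hd bs \<noteq> []"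
    using child[of "hd bs" "hd (hd bs)"] that bs by simp
  have last_gt: "1 < root (last (last bs))" if "last bs \<noteq> []"
    using child[of "last bs" "last (last bs)"] that bs by simp
  have code_\<tau>: "adj_count R (code \<tau>) =
      of_bool (R 1 (hd \<sigma>)) + adj_count R \<sigma> + of_bool (R (last \<sigma>) 1)" for R
    using adj_count_Cons_snoc[OF ne, of R 1 1] by (simp add: t \<sigma>)
  have pad: "card {i \<in> {0..length \<sigma>}. R (padded \<sigma> ! i) (padded \<sigma> ! (i + 1))} =
      of_bool (R 0 (hd \<sigma>)) + adj_count R \<sigma> + of_bool (R (last \<sigma>) 0)" for R
    unfolding padded_adj_count by (rule adj_count_Cons_snoc[OF ne])
  note stats = code_ascents[OF assms(3)] code_descents[OF assms(3)] code_plateaux[OF assms(3)]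
  \<comment> \<open>The pair from 0 to \<open>hd \<sigma>\<close> is always an ascent, the one from
    1 only if the first bundle is non-empty; the final pair is never one. The difference is the
    correction term in \<open>B_A\<close>.\<close>
  have "ascents \<sigma> = B_A \<tau>"
    using pad[of "(<)"] code_\<tau>[of "(<)"] stats(1) hd_gt last_gt
    by (auto simp: ascents_def B_A_def hd_\<sigma> last_\<sigma> t split: if_splits)
  \<comment> \<open>Here the correction comes from the final pair in the same way.\<close>
  moreover have "descents \<sigma> = B_D \<tau>"
    using pad[of "(>)"] code_\<tau>[of "(>)"] stats(2) hd_gt last_gt
    by (auto simp: descents_def B_D_def hd_\<sigma> last_\<sigma> t split: if_splits)
  \<comment> \<open>The pairs with 0 are never plateaux, while those with 1 are plateaux exactly
    when the first, respectively last, bundle is empty. Hence these two root bundles drop out of the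
    count.\<close>
  moreover have "plateaux \<sigma> = B_E k \<tau>"
    using pad[of "(=)"] code_\<tau>[of "(=)"] stats(3) hd_gt last_gt
      empty_bundles_split_root[OF assms(3)] empty_bundles_root[of \<tau> k] len assms(1)
    by (auto simp: plateaux_def B_E_def hd_\<sigma> last_\<sigma> t split: if_splits)
  ultimately show ?thesis by blast
qed

end
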